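(* Let $f,g:\{0,1\}^n\to\{1,-1\}$ be two functions on $n$ variables given by oracle access, and let $\mathbf{y}\in\{0,1\}^n$. Two quantum algorithms $A_1$ and $A_2$ can be designed, each making one query to $f$, one query to $g$ and one further query to the linear function $\mathbb{L}_{\mathbf{y}}$, such that: 1. In algorithm $A_1$, upon measuring $n$ predetermined qubits in the computational basis, the probability of obtaining the all-zero state is $\frac{(C_{f,g}(\mathbf{y}))^2}{2^{2n}}$. 2. In algorithm $A_2$, upon measuring $1$ predetermined qubit in the computational basis, the probability of obtaining the output $0$ is $\frac12\left(1+\frac{C_{f,g}(\mathbf{y})}{2^n}\right)$.
   Context: The cross-correlation of $f,g:\{0,1\}^n\to\{1,-1\}$ at $\mathbf{y}\in\{0,1\}^n$ is $C_{f,g}(\mathbf{y})=\sum_{\mathbf{x}\in\{0,1\}^n}f(\mathbf{x})g(\mathbf{x}\oplus\mathbf{y})$. For $\mathbf{y}\in\{0,1\}^n$ the linear function $\mathbb{L}_{\mathbf{y}}:\{0,1\}^n\to\{1,-1\}$ is $\mathbb{L}_{\mathbf{y}}(\mathbf{x})=(-1)^{\bigoplus_{i:y_i=1}x_i}$. Quantum query (black-box) model: a query to $h:\{0,1\}^n\to\{1,-1\}$ is one application of the unitary $U_h$ on $n+1$ qubits given by $U_h|\mathbf{x}\rangle|a\rangle=|\mathbf{x}\rangle\left|a\oplus\frac{1-h(\mathbf{x})}{2}\right\rangle$, possibly controlled on another qubit; between queries an algorithm may apply arbitrary unitaries that do not depend on the oracle functions, and its starting state is a fixed state independent of the oracle functions.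 *)

theory Defs
  imports
    Complex_Main
    "HOL-Library.FuncSet"
    "Jordan_Normal_Form.Schur_Decomposition"
begin

definition bitstrings :: "nat \<Rightarrow> bool list set" where
  "bitstrings n = {x. length x = n}"

definition xor_bits :: "bool list \<Rightarrow> bool list \<Rightarrow> bool list" where
  "xor_bits x y = map2 (\<noteq>) x y"

definition cross_correlation ::
    "nat \<Rightarrow> (bool list \<Rightarrow> int) \<Rightarrow> (bool list \<Rightarrow> int) \<Rightarrow> bool list \<Rightarrow> int" where
  "cross_correlation n f g y = (\<Sum>x\<in>bitstrings n. f x * g (xor_bits x y))"

(* The exponent is the exclusive or of the selected bits, i.e. their sum modulo 2. *)
definition linear_fun :: "bool list \<Rightarrow> bool list \<Rightarrow> int" where
  "linear_fun y x = (-1) ^ ((\<Sum>i | i < length y \<and> y ! i. of_bool (x ! i)) mod 2)"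

definition unitary_mat :: "nat \<Rightarrow> complex mat \<Rightarrow> bool" where
  "unitary_mat d U \<longleftrightarrow>
     U \<in> carrier_mat d d \<and> U * mat_adjoint U = 1\<^sub>m d \<and> mat_adjoint U * U = 1\<^sub>m d"

(* A register of m qubits has state space of dimension 2^m. Its computational basis states
   are numbered k < 2^m, and qubit q < m has the value bit k q in the basis state k. *)

datatype oracle_label = OracleF | OracleG | OracleL

(* Query r qs t c: a query to the oracle function r whose argument x is held by the qubits qs (x_i in
   the i-th of them), with the answer added to the qubit t, controlled on the qubit c if there
   is one. *)
datatype step =
    Gate "complex mat"
  | Query oracle_label "nat list" nat "nat option"

record algorithm =
  qubits :: nat
  init :: "complex vec"
  steps :: "step list"

fun valid_step :: "nat \<Rightarrow> nat \<Rightarrow> step \<Rightarrow> bool" where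
  "valid_step n m (Gate U) \<longleftrightarrow> unitary_mat (2 ^ m) U"
| "valid_step n m (Query r qs t c) \<longleftrightarrow>
     length qs = n \<and> distinct (t # qs) \<and> set (t # qs) \<subseteq> {..<m} \<and>
     set_option c \<subseteq> {..<m} - set (t # qs)"

definition valid_algorithm :: "nat \<Rightarrow> algorithm \<Rightarrow> bool" where
  "valid_algorithm n A \<longleftrightarrow>
     init A \<in> carrier_vec (2 ^ qubits A) \<and> init A \<bullet>c init A = 1 \<and>
     (\<forall>s\<in>set (steps A). valid_step n (qubits A) s)"

fun queries :: "oracle_label \<Rightarrow> step \<Rightarrow> bool" where
  "queries r (Gate U) \<longleftrightarrow> False"
| "queries r (Query r' qs t c) \<longleftrightarrow> r' = r"

definition query_count :: "algorithm \<Rightarrow> oracle_label \<Rightarrow> nat" where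
  "query_count A r = length (filter (queries r) (steps A))"

(* The action of the query unitary on basis states. The bit added modulo 2 to the target is
   (1 - h x) / 2, so the target is flipped exactly if this is 1. *)
definition query_basis ::
    "(bool list \<Rightarrow> int) \<Rightarrow> nat list \<Rightarrow> nat \<Rightarrow> nat option \<Rightarrow> nat \<Rightarrow> nat" where
  "query_basis h qs t c k =
     (if (\<forall>q\<in>set_option c. bit k q) \<and> (1 - h (map (bit k) qs)) div 2 = 1
      then flip_bit t k else k)"

definition query_mat ::
    "nat \<Rightarrow> (bool list \<Rightarrow> int) \<Rightarrow> nat list \<Rightarrow> nat \<Rightarrow> nat option \<Rightarrow> complex mat" where
  "query_mat m h qs t c =
     mat (2 ^ m) (2 ^ m) (\<lambda>(i, j). if i = query_basis h qs t c j then 1 else 0)"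

fun step_mat :: "nat \<Rightarrow> (oracle_label \<Rightarrow> bool list \<Rightarrow> int) \<Rightarrow> step \<Rightarrow> complex mat" where
  "step_mat m orc (Gate U) = U"
| "step_mat m orc (Query r qs t c) = query_mat m (orc r) qs t c"

definition final_state :: "algorithm \<Rightarrow> (oracle_label \<Rightarrow> bool list \<Rightarrow> int) \<Rightarrow> complex vec" where
  "final_state A orc = foldl (\<lambda>v s. step_mat (qubits A) orc s *\<^sub>v v) (init A) (steps A)"

definition prob_all_zero ::
    "algorithm \<Rightarrow> (oracle_label \<Rightarrow> bool list \<Rightarrow> int) \<Rightarrow> nat set \<Rightarrow> real" where
  "prob_all_zero A orc Q =
     (\<Sum>k | k < 2 ^ qubits A \<and> (\<forall>q\<in>Q. \<not> bit k q). (cmod (final_state A orc $ k))\<^sup>2)"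

definition oracle_answers ::
    "(bool list \<Rightarrow> int) \<Rightarrow> (bool list \<Rightarrow> int) \<Rightarrow> bool list \<Rightarrow> oracle_label \<Rightarrow> bool list \<Rightarrow> int" where
  "oracle_answers f g y r = (case r of OracleF \<Rightarrow> f | OracleG \<Rightarrow> g | OracleL \<Rightarrow> linear_fun y)"

end

theory Submission
  imports Defs
begin

text \<open>
  With the target qubit in the state \<open>|0\<rangle> - |1\<rangle>\<close>, every query multiplies the amplitude of \<open>x\<close> by the
  value of the oracle function at \<open>x\<close>. Hadamard gates around the query to the linear function turn
  its phases into the translation by \<open>y\<close>. So querying \<open>g\<close>, translating, and querying \<open>f\<close> takes the
  uniform superposition to the state with amplitudes proportional to \<open>f x * g (x \<oplus> y)\<close>, whose inner
  product with the uniform superposition is \<open>C / 2 ^ n\<close>. A final layer of Hadamard gates makes this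
  the amplitude of the all-zero state. A Hadamard test, where the queries are controlled
  on a further qubit, yields it linearly in the probability. There the Hadamard gates need no
  control, since they cancel each other if the queries are switched off.
\<close>

unbundle bit_operations_syntax

subsection \<open>Bits and basis states\<close>

text \<open>The argument register of all circuits below is \<open>[0..<n]\<close>, so this is the
  string on which the oracles are queried in the basis state \<open>k\<close>.\<close>

definition bits_of :: "nat \<Rightarrow> nat \<Rightarrow> bool list" where
  "bits_of n k = map (bit k) [0..<n]"

lemma length_bits_of [simp]: "length (bits_of n k) = n"
  by (simp add: bits_of_def)

lemma nth_bits_of [simp]: "i < n \<Longrightarrow> bits_of n k ! i = bit k i"
  by (simp add: bits_of_def)

lemma bits_of_in_bitstrings [simp]: "bits_of n k \<in> bitstrings n"
  by (simp add: bitstrings_def)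

lemma not_bit_if_less_exp:
  fixes k :: nat
  assumes "k < 2 ^ m" "m \<le> q"
  shows "\<not> bit k q"
proof -
  have "take_bit m k = k" using assms(1) by (simp add: take_bit_nat_eq_self)
  then show ?thesis using assms(2) by (metis bit_take_bit_iff not_le)
qed

lemma less_exp_if_not_bit:
  fixes k :: nat
  assumes "\<And>q. m \<le> q \<Longrightarrow> \<not> bit k q"
  shows "k < 2 ^ m"
proof -
  have "take_bit m k = k" using assms by (intro bit_eqI) (metis bit_take_bit_iff not_le)
  then show ?thesis by (metis take_bit_nat_less_exp)
qed

lemma eq_iff_bits_below:
  fixes i j :: nat
  assumes "i < 2 ^ m" "j < 2 ^ m"
  shows "i = j \<longleftrightarrow> (\<forall>q<m. bit i q = bit j q)"
  using not_bit_if_less_exp assms by (auto intro!: bit_eqI) (metis not_le)+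

lemma flip_bit_less_exp:
  fixes k :: nat
  assumes "k < 2 ^ m" "t < m"
  shows "flip_bit t k < 2 ^ m"
  using assms by (intro less_exp_if_not_bit) (auto simp: bit_flip_bit_iff not_bit_if_less_exp)

lemma xor_less_exp:
  fixes k l :: nat
  assumes "k < 2 ^ m" "l < 2 ^ m"
  shows "k XOR l < 2 ^ m"
  using assms by (intro less_exp_if_not_bit) (auto simp: bit_xor_iff not_bit_if_less_exp)

lemma flip_bit_flip_bit [simp]: "flip_bit t (flip_bit t k) = (k :: nat)"
  by (rule bit_eqI) (auto simp: bit_flip_bit_iff)

section \<open>Sums over basis states\<close>

lemma sum_less_exp_Suc:
  "(\<Sum>k<2 ^ Suc m. F k) = (\<Sum>k<2 ^ m. F k + F (set_bit m k))"
  for F :: "nat \<Rightarrow> 'a::comm_monoid_add"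
proof -
  have "(\<Sum>k<2 ^ Suc m. F k) = (\<Sum>k<2 ^ m. F k) + (\<Sum>k=2 ^ m..<2 ^ Suc m. F k)"
    by (subst sum.union_disjoint [symmetric]) (auto intro!: sum.cong)
  also have "(\<Sum>k=2 ^ m..<2 ^ Suc m. F k) = (\<Sum>k<2 ^ m. F (k + 2 ^ m))"
    by (rule sum.reindex_bij_witness [of _ "\<lambda>k. k + 2 ^ m" "\<lambda>k. k - 2 ^ m"]) auto
  also have "\<dots> = (\<Sum>k<2 ^ m. F (set_bit m k))"
    by (intro sum.cong refl) (simp add: set_bit_eq not_bit_if_less_exp)
  finally show ?thesis by (simp add: sum.distrib)
qed

text \<open>The bits of a basis state range independently, so a sum of tensor-product terms
  factorises qubit by qubit. This reduces calculations on \<open>m\<close> qubits to 2x2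
  matrices.\<close>

lemma sum_prod_bits:
  fixes F :: "nat \<Rightarrow> bool \<Rightarrow> 'a::comm_semiring_1"
  shows "(\<Sum>k<2 ^ m. \<Prod>q<m. F q (bit (k::nat) q)) = (\<Prod>q<m. F q False + F q True)"
proof (induction m)
  case (Suc m)
  have "(\<Sum>k<2 ^ Suc m. \<Prod>q<Suc m. F q (bit (k::nat) q)) =
      (\<Sum>k<2 ^ m. (\<Prod>q<m. F q (bit (k::nat) q)) * (F m False + F m True))"
    unfolding sum_less_exp_Suc
    by (intro sum.cong refl)
      (simp add: bit_set_bit_iff not_bit_if_less_exp distrib_left)
  then show ?case by (simp add: Suc.IH flip: sum_distrib_right)
qed simp

lemma prod_of_bool:
  "finite A \<Longrightarrow> (\<Prod>q\<in>A. of_bool (P q)) = (of_bool (\<forall>q\<in>A. P q) :: 'a::comm_semiring_1)"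
  by (induction A rule: finite_induct) auto

text \<open>Least significant bit first, inverse to \<open>bits_of\<close>: translating by
  \<open>y\<close> becomes \<open>XOR\<close> with this number, which leaves the qubits from
  \<open>length y\<close> on unchanged.\<close>

definition bits_value :: "bool list \<Rightarrow> nat" where
  "bits_value y = horner_sum of_bool 2 y"

lemma bit_bits_value: "bit (bits_value y) q \<longleftrightarrow> q < length y \<and> y ! q"
  by (simp add: bits_value_def bit_horner_sum_bit_iff)

lemma bits_value_less: "length y \<le> m \<Longrightarrow> bits_value y < 2 ^ m"
  by (intro less_exp_if_not_bit) (simp add: bit_bits_value)

lemma bits_of_xor:
  "length y = n \<Longrightarrow> bits_of n (k XOR bits_value y) = xor_bits (bits_of n k) y"
  by (intro nth_equalityI) (auto simp: xor_bits_def bit_xor_iff bit_bits_value)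

lemma bits_of_bits_value: "length x = n \<Longrightarrow> bits_of n (bits_value x) = x"
  by (intro nth_equalityI) (auto simp: bit_bits_value)

lemma sum_bitstrings: "(\<Sum>x\<in>bitstrings n. F x) = (\<Sum>k<2 ^ n. F (bits_of n k))"
proof (rule sum.reindex_bij_witness [of _ "bits_of n" bits_value])
  fix x assume "x \<in> bitstrings n"
  then show "bits_of n (bits_value x) = x" "bits_value x \<in> {..<2 ^ n}"
    "F (bits_of n (bits_value x)) = F x"
    by (simp_all add: bitstrings_def bits_of_bits_value bits_value_less)
next
  fix k :: nat assume "k \<in> {..<2 ^ n}"
  then show "bits_value (bits_of n k) = k"
    by (subst eq_iff_bits_below [of _ n]) (auto simp: bit_bits_value bits_value_less)
qed auto

section \<open>The correlation and the linear function in terms of basis states\<close>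

lemma cross_correlation_eq_sum:
  assumes "y \<in> bitstrings n"
  shows "cross_correlation n f g y =
    (\<Sum>k<2 ^ n. f (bits_of n k) * g (bits_of n (k XOR bits_value y)))"
proof -
  have "length y = n" using assms by (simp add: bitstrings_def)
  then show ?thesis by (simp add: cross_correlation_def sum_bitstrings bits_of_xor)
qed

text \<open>One sign per qubit matches the qubitwise form of the Hadamard gates. Qubits from
  \<open>n\<close> on contribute the factor 1, so the product may run up to
  \<open>m\<close>.\<close>

lemma linear_fun_bits_of:
  assumes "length y = n" "n \<le> m"
  shows "linear_fun y (bits_of n k) =
    (\<Prod>q<m. if bit (bits_value y) q \<and> bit k q then - 1 else 1)"
proof -
  have "linear_fun y (bits_of n k) =
      (- 1) ^ (\<Sum>i | i < n \<and> y ! i. of_bool (bits_of n k ! i) :: nat)"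
    using assms(1) by (simp add: linear_fun_def minus_one_power_iff)
  also have "\<dots> = (\<Prod>i | i < n \<and> y ! i. if bit k i then - 1 else 1)"
    by (subst power_sum) (intro prod.cong, auto)
  also have "\<dots> = (\<Prod>q<m. if bit (bits_value y) q \<and> bit k q then - 1 else 1)"
    using assms by (intro prod.mono_neutral_cong_left) (auto simp: bit_bits_value)
  finally show ?thesis .
qed

subsection \<open>Hadamard gates\<close>

text \<open>Entry of a tensor product: the Hadamard matrix on each qubit in \<open>S\<close>, the
  identity on every other.\<close>

definition hadamard_entry :: "nat \<Rightarrow> nat set \<Rightarrow> nat \<Rightarrow> nat \<Rightarrow> complex" where
  "hadamard_entry m S i j =
     (\<Prod>q<m. if q \<in> S then (if bit i q \<and> bit j q then - 1 else 1) / complex_of_real (sqrt 2)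
            else of_bool (bit i q = bit j q))"

definition hadamard_gate :: "nat \<Rightarrow> nat set \<Rightarrow> complex mat" where
  "hadamard_gate m S = mat (2 ^ m) (2 ^ m) (\<lambda>(i, j). hadamard_entry m S i j)"

lemma hadamard_entry_commute: "hadamard_entry m S i j = hadamard_entry m S j i"
  unfolding hadamard_entry_def by (intro prod.cong) auto

lemma cnj_hadamard_entry: "cnj (hadamard_entry m S i j) = hadamard_entry m S i j"
  unfolding hadamard_entry_def cnj_prod by (intro prod.cong) auto

lemma hadamard_entry_nonzeroD:
  assumes "hadamard_entry m S i j \<noteq> 0" "q < m" "q \<notin> S"
  shows "bit i q = bit j q"
  using assms unfolding hadamard_entry_def
  by (auto simp: prod_zero_iff split: if_splits)

lemma hadamard_entry_flip_bit:
  assumes "t \<notin> S"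
  shows "hadamard_entry m S (flip_bit t i) j = hadamard_entry m S i (flip_bit t j)"
  using assms unfolding hadamard_entry_def
  by (intro prod.cong) (auto simp: bit_flip_bit_iff)

text \<open>On a single qubit, conjugating the sign flip Z by Hadamard gives the bit flip X, and
  without the sign the two Hadamards cancel. Signs occur only at qubits in \<open>S\<close>;
  elsewhere the factor is the identity.\<close>

lemma hadamard_sign_hadamard:
  assumes "\<And>q. s q \<Longrightarrow> q \<in> S"
  shows "(\<Sum>w<2 ^ m. hadamard_entry m S i w * (\<Prod>q<m. if s q \<and> bit w q then - 1 else 1)
      * hadamard_entry m S w j) = of_bool (\<forall>q<m. bit j q = (bit i q \<noteq> s q))"
proof -
  \<comment> \<open>The contribution of qubit \<open>q\<close> when the intermediate basis state has
    the bit \<open>b\<close> there.\<close>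
  define F :: "nat \<Rightarrow> bool \<Rightarrow> complex" where "F q b =
     (if q \<in> S then (if bit i q \<and> b then - 1 else 1) / complex_of_real (sqrt 2)
            else of_bool (bit i q = b)) * (if s q \<and> b then - 1 else 1) *
     (if q \<in> S then (if b \<and> bit j q then - 1 else 1) / complex_of_real (sqrt 2)
            else of_bool (b = bit j q))" for q b
  have sq: "complex_of_real (sqrt 2) * complex_of_real (sqrt 2) = 2"
    by (simp flip: of_real_mult)
  have "F q False + F q True = of_bool (bit j q = (bit i q \<noteq> s q))" for q
    using assms [of q] by (auto simp: F_def sq)
  moreover have "(\<Sum>w<2 ^ m. hadamard_entry m S i w * (\<Prod>q<m. if s q \<and> bit w q then - 1 else 1)
      * hadamard_entry m S w j) = (\<Sum>w<2 ^ m. \<Prod>q<m. F q (bit (w :: nat) q))"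
    by (simp add: hadamard_entry_def F_def prod.distrib)
  ultimately show ?thesis
    by (simp add: sum_prod_bits prod_of_bool Ball_def)
qed

lemma hadamard_gate_carrier [simp]: "hadamard_gate m S \<in> carrier_mat (2 ^ m) (2 ^ m)"
  by (simp add: hadamard_gate_def)

lemma unitary_hadamard_gate: "unitary_mat (2 ^ m) (hadamard_gate m S)"
proof -
  \<comment> \<open>The entries are real and symmetric, so unitarity reduces to the gate being its
    own inverse; that is the case of \<open>hadamard_sign_hadamard\<close> without signs.\<close>
  have adj: "mat_adjoint (hadamard_gate m S) = hadamard_gate m S"
    by (rule eq_matI)
      (auto simp: mat_adjoint_def mat_of_rows_def hadamard_gate_def cnj_hadamard_entry
        hadamard_entry_commute)
  have "hadamard_gate m S * hadamard_gate m S = 1\<^sub>m (2 ^ m)"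
  proof (rule eq_matI)
    fix i j :: nat assume "i < dim_row (1\<^sub>m (2 ^ m))" "j < dim_col (1\<^sub>m (2 ^ m))"
    then have ij: "i < 2 ^ m" "j < 2 ^ m" by auto
    then have "(hadamard_gate m S * hadamard_gate m S) $$ (i, j) =
        (\<Sum>w<2 ^ m. hadamard_entry m S i w * hadamard_entry m S w j)"
      by (simp add: hadamard_gate_def scalar_prod_def lessThan_atLeast0)
    also have "\<dots> = of_bool (\<forall>q<m. bit j q = bit i q)"
      using hadamard_sign_hadamard [of "\<lambda>_. False" S m i j] by simp
    also have "\<dots> = 1\<^sub>m (2 ^ m) $$ (i, j)"
      using ij eq_iff_bits_below [OF ij] by auto
    finally show "(hadamard_gate m S * hadamard_gate m S) $$ (i, j) = 1\<^sub>m (2 ^ m) $$ (i, j)" .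
  qed (auto simp: hadamard_gate_def)
  then show ?thesis by (simp add: unitary_mat_def adj)
qed

lemma hadamard_gate_mult_vec:
  "hadamard_gate m S *\<^sub>v vec (2 ^ m) \<phi> =
     vec (2 ^ m) (\<lambda>i. \<Sum>j<2 ^ m. hadamard_entry m S i j * \<phi> j)"
  by (rule eq_vecI) (auto simp: hadamard_gate_def scalar_prod_def lessThan_atLeast0)

subsection \<open>Phase kickback\<close>

text \<open>The factor by which a query acts on the amplitude of \<open>k\<close> once the target
  qubit \<open>n\<close> is in the state |0> - |1>.\<close>

definition phase :: "nat \<Rightarrow> (bool list \<Rightarrow> int) \<Rightarrow> nat option \<Rightarrow> nat \<Rightarrow> complex" where
  "phase n h c k = (if \<forall>q\<in>set_option c. bit k q then of_int (h (bits_of n k)) else 1)"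

lemma bits_of_flip_bit: "bits_of n (flip_bit n k) = bits_of n k"
  by (simp add: bits_of_def bit_flip_bit_iff)

lemma control_flip_bit:
  assumes "n \<notin> set_option c"
  shows "(\<forall>q\<in>set_option c. bit (flip_bit n k) q) \<longleftrightarrow> (\<forall>q\<in>set_option c. bit (k :: nat) q)"
  using assms by (auto simp: bit_flip_bit_iff)

lemma phase_flip_bit:
  assumes "n \<notin> set_option c"
  shows "phase n h c (flip_bit n k) = phase n h c k"
  unfolding phase_def control_flip_bit [OF assms] bits_of_flip_bit ..

text \<open>The flipped target belongs neither to the argument nor to the control, so the condition
  for flipping is the same on the second application.\<close>

lemma query_basis_involutive:
  assumes "n \<notin> set_option c"
  shows "query_basis h [0..<n] n c (query_basis h [0..<n] n c k) = k"
proof (cases "(\<forall>q\<in>set_option c. bit k q) \<and> (1 - h (bits_of n k)) div 2 = 1")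
  case True
  then have "query_basis h [0..<n] n c k = flip_bit n k"
    by (simp add: query_basis_def flip: bits_of_def)
  moreover have "query_basis h [0..<n] n c (flip_bit n k) = k"
    unfolding query_basis_def bits_of_def [symmetric] control_flip_bit [OF assms] bits_of_flip_bit
    using True by simp
  ultimately show ?thesis by simp
next
  case False
  then show ?thesis by (auto simp: query_basis_def simp flip: bits_of_def)
qed

text \<open>Antisymmetry of \<phi> under flipping the target encodes the target state |0> - |1>.
  Flipping the target, which happens exactly where \<open>h\<close> is -1 and the control is on,
  then amounts to a change of sign.\<close>

lemma query_mat_phase:
  assumes h: "h \<in> bitstrings n \<rightarrow> {1, - 1}" and n: "n < m" "n \<notin> set_option c"
    and \<phi>: "\<And>k. \<phi> (flip_bit n k) = - \<phi> k"
  shows "query_mat m h [0..<n] n c *\<^sub>v vec (2 ^ m) \<phi> = vec (2 ^ m) (\<lambda>k. phase n h c k * \<phi> k)"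
proof (rule eq_vecI)
  fix i assume "i < dim_vec (vec (2 ^ m) (\<lambda>k. phase n h c k * \<phi> k))"
  then have i: "i < 2 ^ m" by simp
  let ?b = "query_basis h [0..<n] n c"
  have b: "?b i < 2 ^ m"
    using i n by (simp add: query_basis_def flip_bit_less_exp)
  have "(query_mat m h [0..<n] n c *\<^sub>v vec (2 ^ m) \<phi>) $ i =
      (\<Sum>j<2 ^ m. (if i = ?b j then 1 else 0) * \<phi> j)"
    using i by (simp add: query_mat_def scalar_prod_def lessThan_atLeast0)
  also have "\<dots> = (\<Sum>j<2 ^ m. if j = ?b i then \<phi> j else 0)"
  proof -
    \<comment> \<open>The query permutes basis states and is its own inverse, so row
      \<open>i\<close> has its only nonzero entry in column \<open>?b i\<close>.\<close>
    have "i = ?b j \<longleftrightarrow> j = ?b i" for j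
      using query_basis_involutive [OF n(2)] by metis
    then show ?thesis by (intro sum.cong refl) simp
  qed
  also have "\<dots> = \<phi> (?b i)" using b by simp
  also have "\<dots> = phase n h c i * \<phi> i"
  proof -
    have "h (bits_of n i) \<in> {1, - 1}" using h by (auto simp: Pi_def)
    then show ?thesis
      by (auto simp: query_basis_def phase_def \<phi> simp flip: bits_of_def)
  qed
  finally show "(query_mat m h [0..<n] n c *\<^sub>v vec (2 ^ m) \<phi>) $ i =
      vec (2 ^ m) (\<lambda>k. phase n h c k * \<phi> k) $ i" using i by simp
qed (simp add: query_mat_def)

text \<open>Gates that avoid the target preserve the antisymmetry that phase kickback needs, so one
  target qubit can serve all queries.\<close>

lemma hadamard_sum_flip_bit:
  assumes "t < m" "t \<notin> S" and \<phi>: "\<And>k. \<phi> (flip_bit t k) = - \<phi> k"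
  shows "(\<Sum>j<2 ^ m. hadamard_entry m S (flip_bit t i) j * \<phi> j) =
    - (\<Sum>j<2 ^ m. hadamard_entry m S i j * \<phi> j)"
proof -
  have "(\<Sum>j<2 ^ m. hadamard_entry m S (flip_bit t i) j * \<phi> j) =
      (\<Sum>j<2 ^ m. hadamard_entry m S i j * - \<phi> j)"
    by (rule sum.reindex_bij_witness [of _ "flip_bit t" "flip_bit t"])
      (use assms in \<open>auto simp: flip_bit_less_exp hadamard_entry_flip_bit\<close>)
  then show ?thesis by (simp add: sum_negf)
qed

subsection \<open>The correlation circuit\<close>

definition core_steps :: "nat \<Rightarrow> nat \<Rightarrow> nat option \<Rightarrow> step list" where
  "core_steps n m c =
     [Query OracleG [0..<n] n c, Gate (hadamard_gate m {..<n}), Query OracleL [0..<n] n c,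
      Gate (hadamard_gate m {..<n}), Query OracleF [0..<n] n c]"

text \<open>Qubit \<open>n\<close> is in the state \<open>|0\<rangle> - |1\<rangle>\<close> and all others are in \<open>|0\<rangle> + |1\<rangle>\<close>, up to normalisation.\<close>

definition start_amp :: "nat \<Rightarrow> nat \<Rightarrow> nat \<Rightarrow> complex" where
  "start_amp n m k = (if bit k n then - 1 else 1) / complex_of_real (sqrt (2 ^ m))"

text \<open>Common form of both algorithms. For the first, \<open>c\<close> is absent and
  \<open>S\<close> is the argument register; for the Hadamard test, \<open>c\<close> is an extra
  qubit \<open>n + 1\<close> and \<open>S\<close> consists of it alone. Since the starting state is
  free, the initial Hadamard layer is absorbed into \<open>init\<close>.\<close>

definition correlator :: "nat \<Rightarrow> nat \<Rightarrow> nat option \<Rightarrow> nat set \<Rightarrow> algorithm" where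
  "correlator n m c S = \<lparr>qubits = m, init = vec (2 ^ m) (start_amp n m),
     steps = core_steps n m c @ [Gate (hadamard_gate m S)]\<rparr>"

lemma valid_correlator:
  assumes "n < m" "set_option c \<subseteq> {n<..<m}"
  shows "valid_algorithm n (correlator n m c S)"
proof -
  have "vec (2 ^ m) (start_amp n m) \<bullet>c vec (2 ^ m) (start_amp n m) =
      (\<Sum>k<2 ^ m. start_amp n m k * cnj (start_amp n m k))"
    by (simp add: scalar_prod_def lessThan_atLeast0)
  also have "\<dots> = (\<Sum>k<(2::nat) ^ m. 1 / 2 ^ m)"
    by (intro sum.cong refl) (auto simp: start_amp_def simp flip: of_real_mult)
  also have "\<dots> = 1" by simp
  finally have "vec (2 ^ m) (start_amp n m) \<bullet>c vec (2 ^ m) (start_amp n m) = 1" .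
  then show ?thesis
    using assms
    by (auto simp: valid_algorithm_def correlator_def core_steps_def unitary_hadamard_gate)
qed

lemma query_count_correlator: "query_count (correlator n m c S) r = 1"
  by (cases r) (simp_all add: query_count_def correlator_def core_steps_def)

lemma linear_fun_values: "linear_fun y \<in> bitstrings n \<rightarrow> {1, - 1}"
  by (simp add: linear_fun_def mod_2_eq_odd)

lemma hadamard_phase_hadamard:
  assumes y: "y \<in> bitstrings n" and c: "set_option c \<subseteq> {n<..<m}" and nm: "n < m"
    and i: "i < 2 ^ m" and j: "j < 2 ^ m"
  shows "(\<Sum>w<2 ^ m. hadamard_entry m {..<n} i w *
      (phase n (linear_fun y) c w * hadamard_entry m {..<n} w j)) =
    of_bool (j = (if \<forall>q\<in>set_option c. bit i q then i XOR bits_value y else i))"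
proof -
  let ?p = "\<lambda>i::nat. \<forall>q\<in>set_option c. bit i q"
  \<comment> \<open>Absorbing the control into the sign pattern treats both cases at once: with the
    control off there are no signs and the two layers cancel.\<close>
  let ?s = "\<lambda>q. ?p i \<and> bit (bits_value y) q"
  have len: "length y = n" using y by (simp add: bitstrings_def)
  have "(\<Sum>w<2 ^ m. hadamard_entry m {..<n} i w *
      (phase n (linear_fun y) c w * hadamard_entry m {..<n} w j)) =
    (\<Sum>w<2 ^ m. hadamard_entry m {..<n} i w *
      (\<Prod>q<m. if ?s q \<and> bit w q then - 1 else 1) * hadamard_entry m {..<n} w j)"
  proof (intro sum.cong refl)
    fix w
    show "hadamard_entry m {..<n} i w *
      (phase n (linear_fun y) c w * hadamard_entry m {..<n} w j) =
      hadamard_entry m {..<n} i w *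
      (\<Prod>q<m. if ?s q \<and> bit w q then - 1 else 1) * hadamard_entry m {..<n} w j"
    \<comment> \<open>The phase depends on the control bit of \<open>w\<close>, the claim on that of
      \<open>i\<close>. They agree whenever this entry is nonzero, as the control lies outside
      \<open>{..<n}\<close>; otherwise both sides vanish.\<close>
    proof (cases "hadamard_entry m {..<n} i w = 0")
      case False
      then have "bit i q = bit w q" if "q \<in> set_option c" for q
        using hadamard_entry_nonzeroD that c by fastforce
      then have p: "?p w = ?p i" by simp
      have "complex_of_int (\<Prod>q<m. if bit (bits_value y) q \<and> bit w q then - 1 else 1) =
          (\<Prod>q<m. if bit (bits_value y) q \<and> bit w q then - 1 else 1)"
        unfolding of_int_prod by (intro prod.cong) auto
      then have "phase n (linear_fun y) c w = (\<Prod>q<m. if ?s q \<and> bit w q then - 1 else 1)"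
        unfolding phase_def p using linear_fun_bits_of [of y n m w] len nm by auto
      then show ?thesis by simp
    qed simp
  qed
  also have "\<dots> = of_bool (\<forall>q<m. bit j q = (bit i q \<noteq> ?s q))"
    by (rule hadamard_sign_hadamard) (simp add: bit_bits_value len)
  also have "\<dots> = of_bool (j = (if ?p i then i XOR bits_value y else i))"
    using i j nm len
    by (subst eq_iff_bits_below [of _ m]) (auto simp: bit_xor_iff xor_less_exp bits_value_less)
  finally show ?thesis .
qed

section \<open>The state before the final Hadamard layer\<close>

definition core_amp ::
    "nat \<Rightarrow> nat \<Rightarrow> nat option \<Rightarrow> (bool list \<Rightarrow> int) \<Rightarrow> (bool list \<Rightarrow> int) \<Rightarrow> bool list \<Rightarrow> nat \<Rightarrow> complex"
  where "core_amp n m c f g y k =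
     (if \<forall>q\<in>set_option c. bit k q
      then of_int (f (bits_of n k) * g (bits_of n (k XOR bits_value y))) else 1) * start_amp n m k"

lemma start_amp_flip_bit: "start_amp n m (flip_bit n k) = - start_amp n m k"
  by (simp add: start_amp_def bit_flip_bit_iff)

text \<open>The translation touches only qubits below \<open>n\<close>, whereas the sign comes from
  qubit \<open>n\<close>.\<close>

lemma start_amp_xor:
  "length y = n \<Longrightarrow> start_amp n m (k XOR bits_value y) = start_amp n m k"
  by (simp add: start_amp_def bit_xor_iff bit_bits_value)

lemma core_steps_state:
  assumes f: "f \<in> bitstrings n \<rightarrow> {1, - 1}" and g: "g \<in> bitstrings n \<rightarrow> {1, - 1}"
    and y: "y \<in> bitstrings n" and nm: "n < m" and c: "set_option c \<subseteq> {n<..<m}"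
  shows "foldl (\<lambda>v s. step_mat m (oracle_answers f g y) s *\<^sub>v v) (vec (2 ^ m) (start_amp n m))
      (core_steps n m c) = vec (2 ^ m) (core_amp n m c f g y)"
proof -
  let ?H = "hadamard_entry m {..<n}"
  let ?p = "\<lambda>i::nat. \<forall>q\<in>set_option c. bit i q"
  have len: "length y = n" using y by (simp add: bitstrings_def)
  have nc: "n \<notin> set_option c" using c by auto
  \<comment> \<open>Amplitudes after each of the first four steps. Each stays antisymmetric in the
    target, which the later queries require.\<close>
  define \<phi>1 where "\<phi>1 k = phase n g c k * start_amp n m k" for k
  define \<phi>2 where "\<phi>2 i = (\<Sum>j<2 ^ m. ?H i j * \<phi>1 j)" for i
  define \<phi>3 where "\<phi>3 k = phase n (linear_fun y) c k * \<phi>2 k" for k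
  define \<phi>4 where "\<phi>4 i = (\<Sum>j<2 ^ m. ?H i j * \<phi>3 j)" for i
  have flip1: "\<phi>1 (flip_bit n k) = - \<phi>1 k" for k
    by (simp add: \<phi>1_def phase_flip_bit [OF nc] start_amp_flip_bit)
  have flip2: "\<phi>2 (flip_bit n k) = - \<phi>2 k" for k
    unfolding \<phi>2_def using nm flip1 by (intro hadamard_sum_flip_bit) auto
  have flip3: "\<phi>3 (flip_bit n k) = - \<phi>3 k" for k
    by (simp add: \<phi>3_def phase_flip_bit [OF nc] flip2)
  have flip4: "\<phi>4 (flip_bit n k) = - \<phi>4 k" for k
    unfolding \<phi>4_def using nm flip3 by (intro hadamard_sum_flip_bit) auto
  have \<phi>4: "\<phi>4 i = \<phi>1 (if ?p i then i XOR bits_value y else i)" (is "_ = \<phi>1 ?i")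
    if i: "i < 2 ^ m" for i
  proof -
    have "\<phi>4 i = (\<Sum>w<2 ^ m. \<Sum>j<2 ^ m.
        ?H i w * (phase n (linear_fun y) c w * ?H w j) * \<phi>1 j)"
      by (simp add: \<phi>4_def \<phi>3_def \<phi>2_def sum_distrib_left mult_ac)
    \<comment> \<open>Exchanging the sums isolates the matrix of Hadamard, linear query, Hadamard;
      it is a permutation, so a single \<open>j\<close> survives.\<close>
    also have "\<dots> = (\<Sum>j<2 ^ m. (\<Sum>w<2 ^ m.
        ?H i w * (phase n (linear_fun y) c w * ?H w j)) * \<phi>1 j)"
      by (subst sum.swap) (simp add: sum_distrib_right)
    also have "\<dots> = (\<Sum>j<2 ^ m. if j = ?i then \<phi>1 j else 0)"
      by (intro sum.cong refl) (subst hadamard_phase_hadamard [OF y c nm i], auto)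
    also have "\<dots> = \<phi>1 ?i"
      using i nm len by (subst sum.delta) (auto simp: xor_less_exp bits_value_less)
    finally show ?thesis .
  qed
  have "vec (2 ^ m) (\<lambda>k. phase n f c k * \<phi>4 k) = vec (2 ^ m) (core_amp n m c f g y)"
  proof (rule eq_vecI)
    fix k assume "k < dim_vec (vec (2 ^ m) (core_amp n m c f g y))"
    then have k: "k < 2 ^ m" by simp
    \<comment> \<open>The translation keeps the control bit, so \<open>f\<close> at \<open>k\<close>
      and \<open>g\<close> at the translated state are switched on or off together.\<close>
    have "?p (k XOR bits_value y) = ?p k"
      using c len by (auto simp: bit_xor_iff bit_bits_value)
    then have "phase n f c k * \<phi>4 k = core_amp n m c f g y k"
      by (auto simp: \<phi>4 [OF k] \<phi>1_def phase_def core_amp_def start_amp_xor len)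
    then show "vec (2 ^ m) (\<lambda>k. phase n f c k * \<phi>4 k) $ k =
        vec (2 ^ m) (core_amp n m c f g y) $ k" using k by simp
  qed simp
  then show ?thesis
    by (simp add: core_steps_def oracle_answers_def hadamard_gate_mult_vec
        query_mat_phase [where \<phi> = "start_amp n m", OF g nm nc start_amp_flip_bit]
        \<phi>1_def [symmetric] \<phi>2_def [symmetric]
        query_mat_phase [where \<phi> = \<phi>2, OF linear_fun_values nm nc flip2]
        \<phi>3_def [symmetric] \<phi>4_def [symmetric]
        query_mat_phase [where \<phi> = \<phi>4, OF f nm nc flip4])
qed

lemma final_state_correlator:
  assumes "f \<in> bitstrings n \<rightarrow> {1, - 1}" "g \<in> bitstrings n \<rightarrow> {1, - 1}" "y \<in> bitstrings n"
    "n < m" "set_option c \<subseteq> {n<..<m}"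
  shows "final_state (correlator n m c S) (oracle_answers f g y) =
    vec (2 ^ m) (\<lambda>i. \<Sum>j<2 ^ m. hadamard_entry m S i j * core_amp n m c f g y j)"
  using core_steps_state [OF assms]
  by (simp add: final_state_def correlator_def hadamard_gate_mult_vec)

subsection \<open>Measurement probabilities\<close>

lemma prob_fourier:
  assumes f: "f \<in> bitstrings n \<rightarrow> {1, - 1}" and g: "g \<in> bitstrings n \<rightarrow> {1, - 1}"
    and y: "y \<in> bitstrings n"
  shows "prob_all_zero (correlator n (Suc n) None {..<n}) (oracle_answers f g y) {..<n} =
    (real_of_int (cross_correlation n f g y))\<^sup>2 / 2 ^ (2 * n)"
proof -
  let ?C = "cross_correlation n f g y"
  let ?A = "correlator n (Suc n) None {..<n}"
  have len: "length y = n" using y by (simp add: bitstrings_def)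
  have bs: "bits_of n (set_bit n k) = bits_of n k"
    "bits_of n (set_bit n k XOR bits_value y) = bits_of n (k XOR bits_value y)" for k
    by (auto simp: bits_of_def bit_set_bit_iff bit_xor_iff)
  \<comment> \<open>In a row whose argument bits are all zero every sign is positive, so the
    amplitude is an inner product with the uniform superposition.\<close>
  have H: "hadamard_entry (Suc n) {..<n} i j =
      of_bool (bit i n = bit j n) / complex_of_real (sqrt (2 ^ n))"
    if "\<forall>q<n. \<not> bit i q" for i j
    using that by (simp add: hadamard_entry_def power_divide real_sqrt_power)
  have amp: "final_state ?A (oracle_answers f g y) $ i =
      (if bit i n then - 1 else 1) * complex_of_real (?C / (2 ^ n * sqrt 2))"
    if i: "i < 2 ^ Suc n" "\<forall>q<n. \<not> bit i q" for i
  proof -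
    have "final_state ?A (oracle_answers f g y) $ i = (\<Sum>j<2 ^ Suc n.
        of_bool (bit i n = bit j n) / complex_of_real (sqrt (2 ^ n)) *
        core_amp n (Suc n) None f g y j)"
      using i(1) by (subst final_state_correlator [OF f g y]) (auto simp: H [OF i(2)])
    \<comment> \<open>Splitting off the target qubit \<open>n\<close> leaves only the half whose
      target bit matches \<open>i\<close>, and this bit gives the sign. The two roots normalise the
      Hadamard layer and the starting state.\<close>
    also have "\<dots> = (\<Sum>k<2 ^ n.
        of_int (f (bits_of n k) * g (bits_of n (k XOR bits_value y))) *
        ((if bit i n then - 1 else 1) / complex_of_real (sqrt (2 ^ n) * sqrt (2 ^ Suc n))))"
      unfolding sum_less_exp_Suc
      by (intro sum.cong refl)
        (auto simp: core_amp_def bs start_amp_def not_bit_if_less_exp bit_set_bit_iff)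
    also have "\<dots> = of_int ?C *
        ((if bit i n then - 1 else 1) / complex_of_real (sqrt (2 ^ n) * sqrt (2 ^ Suc n)))"
      by (simp only: cross_correlation_eq_sum [OF y] of_int_sum sum_distrib_right)
    also have "sqrt (2 ^ n) * sqrt (2 ^ Suc n) = 2 ^ n * sqrt 2"
      by (simp add: real_sqrt_mult)
    finally show ?thesis by simp
  qed
  \<comment> \<open>The target is not measured, so both its values count, each contributing half of
    the probability.\<close>
  have set: "{k::nat. k < 2 ^ Suc n \<and> (\<forall>q\<in>{..<n}. \<not> bit k q)} = {0, 2 ^ n}" (is "?L = ?R")
  proof
    show "?R \<subseteq> ?L" by (auto simp: bit_exp_iff)
    show "?L \<subseteq> ?R"
    proof
      fix k assume k: "k \<in> ?L"
      show "k \<in> ?R"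
      proof (cases "bit k n")
        case True
        then have "k = 2 ^ n"
          using k by (subst eq_iff_bits_below [of _ "Suc n"]) (auto simp: bit_exp_iff less_Suc_eq)
        then show ?thesis by simp
      next
        case False
        then have "k = 0"
          using k by (subst eq_iff_bits_below [of _ "Suc n"]) (auto simp: less_Suc_eq)
        then show ?thesis by simp
      qed
    qed
  qed
  have "prob_all_zero ?A (oracle_answers f g y) {..<n} =
      (\<Sum>k\<in>?L. (cmod (final_state ?A (oracle_answers f g y) $ k))\<^sup>2)"
    by (simp add: prob_all_zero_def correlator_def)
  also have "\<dots> = (\<Sum>k\<in>?L. (?C / (2 ^ n * sqrt 2))\<^sup>2)"
  proof (intro sum.cong refl)
    fix k assume "k \<in> ?L"
    then have "cmod (final_state ?A (oracle_answers f g y) $ k) = \<bar>?C / (2 ^ n * sqrt 2)\<bar>"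
      by (subst amp) (auto simp: norm_mult norm_divide simp del: of_real_divide of_real_mult)
    then show "(cmod (final_state ?A (oracle_answers f g y) $ k))\<^sup>2 = (?C / (2 ^ n * sqrt 2))\<^sup>2"
      by (simp only: power2_abs)
  qed
  also have "\<dots> = (real_of_int ?C)\<^sup>2 / 2 ^ (2 * n)"
    unfolding set by (simp add: power_divide power_mult_distrib power_mult mult.commute [of 2 n])
  finally show ?thesis .
qed

text \<open>Where the control is 0, the final Hadamard gate adds the branches without and with the
  queries, which gives the factor 1 + e with e = 1 or e = -1. Then (1 + e)^2 = 2 (1 + e), so the
  correlation enters linearly.\<close>

lemma prob_hadamard_test:
  assumes f: "f \<in> bitstrings n \<rightarrow> {1, - 1}" and g: "g \<in> bitstrings n \<rightarrow> {1, - 1}"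
    and y: "y \<in> bitstrings n"
  shows "prob_all_zero (correlator n (n + 2) (Some (n + 1)) {n + 1}) (oracle_answers f g y) {n + 1} =
    1 / 2 * (1 + real_of_int (cross_correlation n f g y) / 2 ^ n)"
proof -
  let ?C = "cross_correlation n f g y"
  let ?A = "correlator n (n + 2) (Some (n + 1)) {n + 1}"
  let ?e = "\<lambda>k. f (bits_of n k) * g (bits_of n (k XOR bits_value y))"
  have bs: "bits_of n (set_bit t k) = bits_of n k"
    "bits_of n (set_bit t k XOR bits_value y) = bits_of n (k XOR bits_value y)" if "n \<le> t" for k t
    using that by (auto simp: bits_of_def bit_set_bit_iff bit_xor_iff)
  have e: "?e k = 1 \<or> ?e k = - 1" for k
  proof -
    have "f (bits_of n k) \<in> {1, - 1}" "g (bits_of n (k XOR bits_value y)) \<in> {1, - 1}"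
      using f g by (auto simp: Pi_def)
    then show ?thesis by auto
  qed
  have H: "hadamard_entry (n + 2) {n + 1} i j =
      of_bool (\<forall>q<Suc n. bit i q = bit j q) / complex_of_real (sqrt 2)"
    if "\<not> bit i (n + 1)" for i j
    using that by (simp add: hadamard_entry_def prod_of_bool less_Suc_eq) auto
  have amp: "final_state ?A (oracle_answers f g y) $ i =
      (1 + of_int (?e i)) * start_amp n (n + 2) i / complex_of_real (sqrt 2)"
    if i: "i < 2 ^ Suc n" for i
  proof -
    have ni: "\<not> bit i (n + 1)" using not_bit_if_less_exp [OF i] by simp
    have i': "i < 2 ^ (n + 2)" using i by simp
    have eq: "(\<forall>q<Suc n. bit i q = bit j q) \<longleftrightarrow> j = i" if "j < 2 ^ Suc n" for j
      using eq_iff_bits_below [OF i that] by auto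
    have "final_state ?A (oracle_answers f g y) $ i = (\<Sum>j<2 ^ (n + 2).
        hadamard_entry (n + 2) {n + 1} i j * core_amp n (n + 2) (Some (n + 1)) f g y j)"
      using i' by (subst final_state_correlator [OF f g y]) auto
    also have "\<dots> = (\<Sum>j<2 ^ Suc (Suc n).
        of_bool (\<forall>q<Suc n. bit i q = bit j q) / complex_of_real (sqrt 2) *
        core_amp n (n + 2) (Some (n + 1)) f g y j)"
      unfolding H [OF ni] by simp
    also have "\<dots> = (\<Sum>j<2 ^ Suc n. if j = i then
        (1 + of_int (?e j)) * start_amp n (n + 2) j / complex_of_real (sqrt 2) else 0)"
      \<comment> \<open>Splits off the control, the top qubit \<open>n + 1\<close>: it is off in
        \<open>j\<close> and on in \<open>set_bit (Suc n) j\<close>.\<close>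
      unfolding sum_less_exp_Suc [of _ "Suc n"]
    proof (intro sum.cong refl)
      fix j :: nat assume "j \<in> {..<2 ^ Suc n}"
      then have j: "j < 2 ^ Suc n" by simp
      have 1: "core_amp n (n + 2) (Some (n + 1)) f g y j = start_amp n (n + 2) j"
        using not_bit_if_less_exp [OF j, of "n + 1"] by (simp add: core_amp_def)
      have 2: "core_amp n (n + 2) (Some (n + 1)) f g y (set_bit (Suc n) j) =
          of_int (?e j) * start_amp n (n + 2) j"
        by (simp add: core_amp_def bs bit_set_bit_iff start_amp_def)
      have 3: "(\<forall>q<Suc n. bit i q = bit (set_bit (Suc n) j) q) \<longleftrightarrow> j = i"
        using eq [OF j] by (auto simp: bit_set_bit_iff)
      show "of_bool (\<forall>q<Suc n. bit i q = bit j q) / complex_of_real (sqrt 2) *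
          core_amp n (n + 2) (Some (n + 1)) f g y j +
          of_bool (\<forall>q<Suc n. bit i q = bit (set_bit (Suc n) j) q) / complex_of_real (sqrt 2) *
          core_amp n (n + 2) (Some (n + 1)) f g y (set_bit (Suc n) j) =
          (if j = i then (1 + of_int (?e j)) * start_amp n (n + 2) j / complex_of_real (sqrt 2)
           else 0)"
        unfolding 1 2 3 eq [OF j] by (simp add: field_simps)
    qed
    also have "\<dots> = (1 + of_int (?e i)) * start_amp n (n + 2) i / complex_of_real (sqrt 2)"
      using i by (subst sum.delta) auto
    finally show ?thesis .
  qed
  have set: "{k::nat. k < 2 ^ (n + 2) \<and> (\<forall>q\<in>{n + 1}. \<not> bit k q)} = {..<2 ^ Suc n}" (is "?L = ?R")
  proof
    show "?R \<subseteq> ?L" using not_bit_if_less_exp [of _ "Suc n"] by auto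
    show "?L \<subseteq> ?R"
    proof
      fix k assume k: "k \<in> ?L"
      then have "\<not> bit k q" if "Suc n \<le> q" for q
        using that not_bit_if_less_exp [of k "n + 2" q] by (cases "q = Suc n") auto
      then show "k \<in> ?R" using less_exp_if_not_bit [of "Suc n" k] by blast
    qed
  qed
  have "prob_all_zero ?A (oracle_answers f g y) {n + 1} =
      (\<Sum>k\<in>?L. (cmod (final_state ?A (oracle_answers f g y) $ k))\<^sup>2)"
    by (simp add: prob_all_zero_def correlator_def)
  also have "\<dots> = (\<Sum>k<2 ^ Suc n. (1 + real_of_int (?e k)) / 2 ^ (n + 2))"
    unfolding set
  proof (intro sum.cong refl)
    fix k :: nat assume "k \<in> {..<2 ^ Suc n}"
    then have k: "k < 2 ^ Suc n" by simp
    have s: "(cmod (start_amp n (n + 2) k))\<^sup>2 = 1 / 2 ^ (n + 2)"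
      by (simp add: start_amp_def norm_divide power_divide)
    have "(cmod (1 + of_int a))\<^sup>2 = 2 * (1 + real_of_int a)" if "a = 1 \<or> a = - 1" for a
      using that by auto
    from this [OF e [of k]] show "(cmod (final_state ?A (oracle_answers f g y) $ k))\<^sup>2 =
        (1 + real_of_int (?e k)) / 2 ^ (n + 2)"
      unfolding amp [OF k] norm_divide norm_mult power_divide power_mult_distrib s
      by (simp add: field_simps)
  qed
  \<comment> \<open>Splits off the target qubit \<open>n\<close>: \<open>?e\<close> does not depend
    on it, so both halves are equal.\<close>
  also have "\<dots> = 2 * (\<Sum>k<2 ^ n. (1 + real_of_int (?e k)) / 2 ^ (n + 2))"
    unfolding sum_less_exp_Suc [of _ n] sum_distrib_left
    by (intro sum.cong refl) (simp add: bs field_simps)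
  also have "\<dots> = 2 * ((2 ^ n + real_of_int ?C) / 2 ^ (n + 2))"
    by (simp add: cross_correlation_eq_sum [OF y] sum.distrib flip: sum_divide_distrib)
  also have "\<dots> = 1 / 2 * (1 + real_of_int ?C / 2 ^ n)"
    by (simp add: field_simps)
  finally show ?thesis .
qed

theorem theorem6:
  fixes n :: nat
  shows
    "(\<exists>A\<^sub>1 Q.
        valid_algorithm n A\<^sub>1 \<and> (\<forall>r. query_count A\<^sub>1 r = 1) \<and>
        Q \<subseteq> {..<qubits A\<^sub>1} \<and> card Q = n \<and>
        (\<forall>f \<in> bitstrings n \<rightarrow> {1, -1}. \<forall>g \<in> bitstrings n \<rightarrow> {1, -1}. \<forall>y \<in> bitstrings n.
           prob_all_zero A\<^sub>1 (oracle_answers f g y) Q =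
             (real_of_int (cross_correlation n f g y))\<^sup>2 / 2 ^ (2 * n))) \<and>
     (\<exists>A\<^sub>2 q.
        valid_algorithm n A\<^sub>2 \<and> (\<forall>r. query_count A\<^sub>2 r = 1) \<and>
        q < qubits A\<^sub>2 \<and>
        (\<forall>f \<in> bitstrings n \<rightarrow> {1, -1}. \<forall>g \<in> bitstrings n \<rightarrow> {1, -1}. \<forall>y \<in> bitstrings n.
           prob_all_zero A\<^sub>2 (oracle_answers f g y) {q} =
             1 / 2 * (1 + real_of_int (cross_correlation n f g y) / 2 ^ n)))"
proof (intro conjI exI ballI allI)
  \<comment> \<open>The goals shown here fix the existential witnesses. Neither circuit mentions
    \<open>f\<close>, \<open>g\<close> or \<open>y\<close>; the first measures the argument
    register, the second the control.\<close>
  show "prob_all_zero (correlator n (Suc n) None {..<n}) (oracle_answers f g y) {..<n} =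
      (real_of_int (cross_correlation n f g y))\<^sup>2 / 2 ^ (2 * n)"
    if "f \<in> bitstrings n \<rightarrow> {1, -1}" "g \<in> bitstrings n \<rightarrow> {1, -1}" "y \<in> bitstrings n" for f g y
    using that by (rule prob_fourier)
  show "prob_all_zero (correlator n (n + 2) (Some (n + 1)) {n + 1}) (oracle_answers f g y) {n + 1} =
      1 / 2 * (1 + real_of_int (cross_correlation n f g y) / 2 ^ n)"
    if "f \<in> bitstrings n \<rightarrow> {1, -1}" "g \<in> bitstrings n \<rightarrow> {1, -1}" "y \<in> bitstrings n" for f g y
    using that by (rule prob_hadamard_test)
  show "query_count (correlator n (Suc n) None {..<n}) r = 1"
    "query_count (correlator n (n + 2) (Some (n + 1)) {n + 1}) r = 1" for r
    by (rule query_count_correlator)+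
  show "valid_algorithm n (correlator n (Suc n) None {..<n})"
    "valid_algorithm n (correlator n (n + 2) (Some (n + 1)) {n + 1})"
    by (rule valid_correlator; simp)+
qed (auto simp: correlator_def)

end
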